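(* Let $d\ge 3$ and let $\mathbf{M}\subset \mathbf{E}^d$ be an almost smooth convex body. Then $X(\mathbf{M})=d$.
   Context: $\mathbf{E}^d$ is $d$-dimensional Euclidean space with the standard inner product. A convex body in $\mathbf{E}^d$ is a compact convex set with non-empty interior. X-ray number: for a convex body $\mathbf{K}\subset\mathbf{E}^d$ and a line $L$ through the origin, a point $p\in\mathbf{K}$ is X-rayed along $L$ if the line parallel to $L$ passing through $p$ intersects the interior of $\mathbf{K}$. The X-ray number $X(\mathbf{K})$ is the smallest number of lines through the origin such that every point of $\mathbf{K}$ is X-rayed along at least one of these lines. Almost smooth: for a convex body $\mathbf{M}\subset\mathbf{E}^d$ and a boundary point $b$ of $\mathbf{M}$, let $N_b$ denote the set of (nonzero) outer normal vectors of all supporting hyperplanes of $\mathbf{M}$ at $b$. $\mathbf{M}$ is called almost smooth if for each boundary point $b$ of $\mathbf{M}$ and any $\mathbf{n}_i,\mathbf{n}_j\in N_b$ one has $$\frac{\mathbf{n}_i\cdot\mathbf{n}_j}{\|\mathbf{n}_i\|\cdot\|\mathbf{n}_j\|}\ge\frac{d-2}{d-1}.$$ *)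

theory Defs
  imports "HOL-Analysis.Analysis"
begin

definition convex_body :: "'a::euclidean_space set \<Rightarrow> bool" where
  "convex_body K \<longleftrightarrow> compact K \<and> convex K \<and> interior K \<noteq> {}"

definition origin_line :: "'a::euclidean_space set \<Rightarrow> bool" where
  "origin_line L \<longleftrightarrow> subspace L \<and> dim L = 1"

definition xrayed_along :: "'a::euclidean_space set \<Rightarrow> 'a set \<Rightarrow> 'a \<Rightarrow> bool" where
  "xrayed_along K L p \<longleftrightarrow> (+) p ` L \<inter> interior K \<noteq> {}"

text \<open>By compactness, every convex body (in positive dimension) is X-rayed along finitely
  many lines, so the minimum below exists for convex bodies.\<close>

definition xray_number :: "'a::euclidean_space set \<Rightarrow> nat" where
  "xray_number K =
    (LEAST n. \<exists>\<L>. finite \<L> \<and> card \<L> = n \<and> (\<forall>L\<in>\<L>. origin_line L) \<and>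
       (\<forall>p\<in>K. \<exists>L\<in>\<L>. xrayed_along K L p))"

text \<open>A nonzero \<open>n\<close> is an outer normal at \<open>b\<close> when the hyperplane through \<open>b\<close> orthogonal
  to \<open>n\<close> supports \<open>M\<close>, with \<open>n\<close> pointing away from \<open>M\<close>.\<close>

definition outer_normals :: "'a::euclidean_space set \<Rightarrow> 'a \<Rightarrow> 'a set" where
  "outer_normals M b = {n. n \<noteq> 0 \<and> (\<forall>x\<in>M. n \<bullet> x \<le> n \<bullet> b)}"

definition almost_smooth :: "'a::euclidean_space set \<Rightarrow> bool" where
  "almost_smooth M \<longleftrightarrow>
    (\<forall>b\<in>frontier M. \<forall>m\<in>outer_normals M b. \<forall>n\<in>outer_normals M b.
       (m \<bullet> n) / (norm m * norm n) \<ge> (real DIM('a) - 2) / (real DIM('a) - 1))"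

end

theory Submission
  imports Defs
begin

text \<open>
  Fewer than \<open>d\<close> lines never suffice: a direction orthogonal to all of them has a support
  hyperplane whose contact points are not X-rayed. Conversely, a boundary point \<open>b\<close> is missed
  by the lines of an orthonormal frame \<open>f\<close> only if there are unit normals \<open>n\<^sub>k\<close> at \<open>b\<close> with
  \<open>n\<^sub>k \<bullet> f\<^sub>k = 0\<close> for every \<open>k\<close>. The Cauchy-Schwarz inequality, applied to each column of the
  matrix \<open>n\<^sub>k \<bullet> f\<^sub>l\<close>, gives \<open>\<parallel>\<Sum>n\<^sub>k\<parallel>\<^sup>2 \<le> d (d - 1)\<close>, while almost smoothness gives the reverse
  inequality; so equality holds and, up to scaling, \<open>n\<^sub>k = \<Sum>\<^bsub>l \<noteq> k\<^esub> s\<^sub>l f\<^sub>l\<close> with signs \<open>s\<^sub>l\<close>.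
  Equality can occur, so the frame has to be chosen. Rotate one frame in a fixed coordinate plane
  by angles \<open>t \<in> [0, 1]\<close>. A given \<open>b\<close> is missed for at most one \<open>t\<close>, and the missed points have normal
  cones with nonempty, pairwise disjoint interiors, so only countably many \<open>t\<close> are bad.
\<close>

section \<open>Cones of outer normals\<close>

lemma outer_normals_combination:
  assumes n: "\<And>k. k \<in> A \<Longrightarrow> n k \<in> outer_normals M b"
    and c: "\<And>k. k \<in> A \<Longrightarrow> c k > 0"
    and nz: "(\<Sum>k\<in>A. c k *\<^sub>R n k) \<noteq> 0"
  shows "(\<Sum>k\<in>A. c k *\<^sub>R n k) \<in> outer_normals M b"
proof -
  have "(\<Sum>k\<in>A. c k *\<^sub>R n k) \<bullet> x \<le> (\<Sum>k\<in>A. c k *\<^sub>R n k) \<bullet> b" if "x \<in> M" for x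
    unfolding inner_sum_left inner_scaleR_left
    using n c that by (intro sum_mono mult_left_mono) (auto simp: outer_normals_def less_imp_le)
  then show ?thesis using nz by (auto simp: outer_normals_def)
qed

lemma outer_normals_scaleR:
  "n \<in> outer_normals M b \<Longrightarrow> c > 0 \<Longrightarrow> c *\<^sub>R n \<in> outer_normals M b"
  by (auto simp: outer_normals_def)

text \<open>A common normal attains its maximum over \<open>M\<close> at both points, so it is
  orthogonal to \<open>b - c\<close>. Common normals therefore lie in a hyperplane, which has empty
  interior.\<close>

lemma interior_outer_normals_disjoint:
  fixes M :: "'a::euclidean_space set"
  assumes "b \<in> M" "c \<in> M" "b \<noteq> c"
  shows "interior (outer_normals M b) \<inter> interior (outer_normals M c) = {}"
proof (rule ccontr)
  let ?I = "interior (outer_normals M b \<inter> outer_normals M c)"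
  assume "\<not> ?thesis"
  then obtain n where "n \<in> ?I" by auto
  then obtain e where e: "e > 0" "cball n e \<subseteq> ?I"
    using open_contains_cball open_interior by blast
  have eq: "m \<bullet> (b - c) = 0" if "m \<in> ?I" for m
  proof -
    have "m \<in> outer_normals M b" "m \<in> outer_normals M c" using that interior_subset by blast+
    then show ?thesis using assms(1,2) by (fastforce simp: outer_normals_def inner_diff_right)
  qed
  \<comment> \<open>Moving \<open>n\<close> a distance \<open>e\<close> towards \<open>b - c\<close>
    stays in the ball but changes the inner product with \<open>b - c\<close> by
    \<open>e * norm (b - c)\<close>.\<close>
  define m where "m = n + (e / norm (b - c)) *\<^sub>R (b - c)"
  have "m \<in> cball n e" using e assms(3) by (simp add: m_def dist_norm)
  then have "m \<bullet> (b - c) = 0" "n \<bullet> (b - c) = 0" using e eq \<open>n \<in> ?I\<close> by blast+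
  then show False using e assms(3) by (simp add: m_def inner_add_left)
qed

text \<open>Separate the line from the interior. A linear functional bounded below on a line is
  constant along it, which gives orthogonality to \<open>v\<close>. Since \<open>M\<close> is the
  closure of its interior and \<open>b\<close> lies on the line, the separating functional is
  maximal over \<open>M\<close> at \<open>b\<close>.\<close>

lemma obtain_normal_not_xrayed:
  fixes M :: "'a::euclidean_space set"
  assumes "convex_body M" "b \<in> M" "\<not> xrayed_along M (span {v}) b"
  obtains n where "n \<in> outer_normals M b" "n \<bullet> v = 0"
proof -
  let ?L = "(+) b ` span {v}"
  have cl: "closure (interior M) = M"
    using assms(1) convex_closure_interior[of M]
    by (auto simp: convex_body_def compact_imp_closed closure_closed)
  have "convex (interior M)" "interior M \<noteq> {}"
    using assms(1) by (auto simp: convex_body_def intro: convex_interior)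
  moreover have "convex ?L" "?L \<noteq> {}"
    by (auto intro!: convex_translation subspace_imp_convex span_zero)
  moreover have "interior M \<inter> ?L = {}" using assms(3) by (auto simp: xrayed_along_def)
  ultimately obtain n \<beta> where n: "n \<noteq> 0" "\<And>x. x \<in> interior M \<Longrightarrow> n \<bullet> x \<le> \<beta>"
    "\<And>x. x \<in> ?L \<Longrightarrow> n \<bullet> x \<ge> \<beta>"
    using separating_hyperplane_sets[of "interior M" ?L] by blast
  have L: "\<beta> \<le> n \<bullet> b + t * (n \<bullet> v)" for t
  proof -
    have "b + t *\<^sub>R v \<in> ?L" by (simp add: span_base span_mul)
    then show ?thesis using n(3)[of "b + t *\<^sub>R v"] by (simp add: inner_add_right)
  qed
  have "n \<bullet> v = 0"
  proof (rule ccontr)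
    assume "n \<bullet> v \<noteq> 0"
    \<comment> \<open>At this parameter the right-hand side of \<open>L\<close> equals
      \<open>\<beta> - 1\<close>.\<close>
    then show False using L[of "(\<beta> - n \<bullet> b - 1) / (n \<bullet> v)"] by simp
  qed
  moreover have "n \<bullet> x \<le> n \<bullet> b" if "x \<in> M" for x
  proof -
    have "closure (interior M) \<subseteq> {x. n \<bullet> x \<le> \<beta>}"
      using n(2) by (intro closure_minimal) (auto simp: closed_halfspace_le)
    then show ?thesis using that cl L[of 0] by fastforce
  qed
  ultimately show ?thesis using that n(1) by (auto simp: outer_normals_def)
qed

section \<open>Lower bound for the number of lines\<close>

lemma xrayed_along_interior: "origin_line L \<Longrightarrow> p \<in> interior K \<Longrightarrow> xrayed_along K L p"
  by (force simp: origin_line_def xrayed_along_def dest: subspace_0)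

lemma card_xraying_lines_ge:
  fixes K :: "'a::euclidean_space set"
  assumes "convex_body K" "finite \<L>" "\<forall>L\<in>\<L>. origin_line L" "\<forall>p\<in>K. \<exists>L\<in>\<L>. xrayed_along K L p"
  shows "DIM('a) \<le> card \<L>"
proof (rule ccontr)
  assume less: "\<not> ?thesis"
  have "\<exists>v. L = span {v}" if "L \<in> \<L>" for L
  proof -
    have "subspace L" "dim L = 1" using assms(3) that by (auto simp: origin_line_def)
    moreover obtain B where "B \<subseteq> L" "independent B" "L \<subseteq> span B" "card B = dim L"
      using basis_exists by blast
    ultimately show ?thesis by (metis card_1_singletonE span_subspace)
  qed
  then obtain v where v: "\<And>L. L \<in> \<L> \<Longrightarrow> L = span {v L}" by metis
  have "dim (v ` \<L>) \<le> card \<L>"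
    by (meson assms(2) card_image_le dim_le_card' finite_imageI le_trans)
  then obtain n where n: "n \<noteq> 0" "\<And>y. y \<in> span (v ` \<L>) \<Longrightarrow> orthogonal n y"
    using less orthogonal_to_subspace_exists[of "v ` \<L>"] by auto
  \<comment> \<open>A contact point \<open>p\<close> of the support hyperplane with normal
    \<open>n\<close> exists by compactness.\<close>
  have "compact K" "K \<noteq> {}" using assms(1) interior_subset by (auto simp: convex_body_def)
  moreover have "continuous_on K (\<lambda>x. n \<bullet> x)" by (intro continuous_intros)
  ultimately obtain p where p: "p \<in> K" "\<And>x. x \<in> K \<Longrightarrow> n \<bullet> x \<le> n \<bullet> p"
    using continuous_attains_sup[of K "\<lambda>x. n \<bullet> x"] by blast
  then obtain L u where L: "L \<in> \<L>" "u \<in> L" "p + u \<in> interior K"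
    using assms(4) unfolding xrayed_along_def by blast
  have "u \<in> span (v ` \<L>)"
    using L v[OF L(1)] span_mono[of "{v L}" "v ` \<L>"] by auto
  then have u: "n \<bullet> u = 0" using n(2) by (auto simp: orthogonal_def)
  obtain e where e: "e > 0" "cball (p + u) e \<subseteq> K" using L(3) mem_interior_cball by blast
  \<comment> \<open>The point \<open>p + u\<close> has the same height as \<open>p\<close> in
    direction \<open>n\<close>. Being interior, it can be pushed further along \<open>n\<close>
    inside \<open>K\<close>, beyond the maximal height.\<close>
  have "p + u + (e / norm n) *\<^sub>R n \<in> cball (p + u) e" using e(1) by (simp add: dist_norm)
  then have "n \<bullet> (p + u + (e / norm n) *\<^sub>R n) \<le> n \<bullet> p" using e p by blast
  then have "(e / norm n) * (n \<bullet> n) \<le> 0" using u by (simp add: inner_add_right)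
  moreover have "(e / norm n) * (n \<bullet> n) > 0" using e(1) n(1) by simp
  ultimately show False by simp
qed

section \<open>Orthonormal frames and their corner vectors\<close>

text \<open>\<open>Basis\<close> serves merely as an index set of the right size; the vector
  \<open>f k\<close> need not be related to \<open>k\<close>.\<close>

definition orthonormal_frame :: "('a \<Rightarrow> 'a::euclidean_space) \<Rightarrow> bool" where
  "orthonormal_frame f \<longleftrightarrow> (\<forall>k\<in>Basis. \<forall>l\<in>Basis. f k \<bullet> f l = (if k = l then 1 else 0))"

lemma orthonormal_frame_inner_sum:
  fixes f :: "'a::euclidean_space \<Rightarrow> 'a"
  assumes "orthonormal_frame f" "A \<subseteq> Basis" "l \<in> Basis"
  shows "(\<Sum>k\<in>A. c k *\<^sub>R f k) \<bullet> f l = (if l \<in> A then c l else 0)"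
proof -
  have A: "finite A" using assms(2) by (rule finite_subset) simp
  have "(\<Sum>k\<in>A. c k *\<^sub>R f k) \<bullet> f l = (\<Sum>k\<in>A. if l = k then c k else 0)"
    unfolding inner_sum_left inner_scaleR_left
    using assms by (intro sum.cong) (auto simp: orthonormal_frame_def)
  then show ?thesis using A by simp
qed

lemma orthonormal_frame_expansion:
  fixes x :: "'a::euclidean_space"
  assumes "orthonormal_frame f"
  shows "(\<Sum>k\<in>Basis. (x \<bullet> f k) *\<^sub>R f k) = x"
proof -
  have inj: "inj_on f Basis"
    using assms by (intro inj_onI) (metis orthonormal_frame_def zero_neq_one)
  have "pairwise orthogonal (f ` Basis)"
    using assms by (auto simp: pairwise_def orthogonal_def orthonormal_frame_def)
  moreover have "0 \<notin> f ` Basis"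
    using assms by (force simp: orthonormal_frame_def)
  ultimately have "independent (f ` Basis)" by (rule pairwise_orthogonal_independent)
  moreover have "card (f ` Basis) = DIM('a)" using inj by (rule card_image)
  ultimately have sp: "span (f ` Basis) = UNIV"
    by (metis dim_eq_card_independent dim_eq_full dim_span)
  define y where "y = x - (\<Sum>k\<in>Basis. (x \<bullet> f k) *\<^sub>R f k)"
  have "orthogonal y z" if "z \<in> f ` Basis" for z
    using that assms
    by (auto simp: orthogonal_def y_def inner_diff_left
        orthonormal_frame_inner_sum[OF assms order_refl])
  \<comment> \<open>The residual \<open>y\<close> is orthogonal to a spanning set, hence to
    itself.\<close>
  then have "orthogonal y y" using sp by (metis UNIV_I orthogonal_to_span)
  then show ?thesis by (simp add: y_def orthogonal_self)
qed

lemma orthonormal_frame_inner: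
  fixes x :: "'a::euclidean_space"
  assumes "orthonormal_frame f"
  shows "x \<bullet> y = (\<Sum>k\<in>Basis. (x \<bullet> f k) * (y \<bullet> f k))"
proof -
  have "x \<bullet> y = x \<bullet> (\<Sum>k\<in>Basis. (y \<bullet> f k) *\<^sub>R f k)"
    by (simp add: orthonormal_frame_expansion[OF assms])
  then show ?thesis by (simp add: inner_sum_right mult.commute)
qed

text \<open>For signs \<open>s\<close> and \<open>k\<close> in \<open>Basis\<close>, this is the
  midpoint of the edge in direction \<open>f k\<close> at the vertex with sign vector
  \<open>s\<close> of the cube with side length 2, centred at 0 and aligned with the frame.\<close>

definition corner :: "('a \<Rightarrow> 'a) \<Rightarrow> ('a \<Rightarrow> real) \<Rightarrow> 'a \<Rightarrow> 'a::euclidean_space" where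
  "corner f s k = (\<Sum>l\<in>Basis - {k}. s l *\<^sub>R f l)"

lemma corner_inner_frame:
  "orthonormal_frame f \<Longrightarrow> l \<in> Basis \<Longrightarrow> corner f s k \<bullet> f l = (if l = k then 0 else s l)"
  by (simp add: corner_def orthonormal_frame_inner_sum)

lemma norm_corner:
  fixes f :: "'a \<Rightarrow> 'a::euclidean_space"
  assumes "orthonormal_frame f" "k \<in> Basis" "\<And>l. l \<in> Basis \<Longrightarrow> s l \<in> {1, -1}"
  shows "norm (corner f s k) = sqrt (real DIM('a) - 1)"
proof -
  have "corner f s k \<bullet> corner f s k = (\<Sum>l\<in>Basis. if l = k then 0 else (s l)\<^sup>2)"
    unfolding orthonormal_frame_inner[OF assms(1), of "corner f s k" "corner f s k"]
    using assms by (intro sum.cong) (auto simp: corner_inner_frame power2_eq_square)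
  also have "\<dots> = (\<Sum>l\<in>Basis. if l = k then 0 else 1)"
    using assms(3) by (intro sum.cong) (auto simp: power2_eq_1_iff)
  also have "\<dots> = (\<Sum>l\<in>Basis - {k}. 1)"
    by (rule sum.mono_neutral_cong_right) auto
  also have "\<dots> = real DIM('a) - 1"
    using assms(2) DIM_positive[where 'a='a] by (simp add: card_Diff_singleton of_nat_diff Suc_leI)
  finally show ?thesis by (simp add: norm_eq_sqrt_inner)
qed

text \<open>The corners form a basis of the space, so their strictly positive combinations fill an
  open cone. This cone consists of outer normals at \<open>b\<close>.\<close>

lemma interior_outer_normals_corners:
  fixes M :: "'a::euclidean_space set"
  assumes d: "DIM('a) \<ge> 2" and f: "orthonormal_frame f"
    and s: "\<And>l. l \<in> Basis \<Longrightarrow> s l \<in> {1, -1}"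
    and g: "\<And>k. k \<in> Basis \<Longrightarrow> corner f s k \<in> outer_normals M b"
  shows "interior (outer_normals M b) \<noteq> {}"
proof -
  let ?d = "real DIM('a)"
  \<comment> \<open>If \<open>x\<close> is the sum of
    \<open>c k *\<^sub>R (w - s k *\<^sub>R f k)\<close> and C is the sum of the \<open>c k\<close>,
    then \<open>s l * (x \<bullet> f l)\<close> equals C - \<open>c l\<close>. Summing over
    \<open>l\<close> gives \<open>S x\<close> = (d - 1) C, and one solves for
    \<open>c l\<close>.\<close>
  define S where "S x = (\<Sum>l\<in>Basis. s l * (x \<bullet> f l))" for x
  \<comment> \<open>\<open>c x k\<close> is the coordinate of \<open>x\<close> with respect to the basis of corners.\<close>
  define c where "c x k = S x / (?d - 1) - s k * (x \<bullet> f k)" for x k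
  define w where "w = (\<Sum>l\<in>Basis. s l *\<^sub>R f l)"
  have wf: "w \<bullet> f l = s l" if "l \<in> Basis" for l
    using that f by (simp add: w_def orthonormal_frame_inner_sum)
  have ss: "s l * s l = 1" if "l \<in> Basis" for l using s[OF that] by auto
  define U where "U = (\<Inter>k\<in>Basis. {x. 0 < c x k})"
  have "open U" unfolding U_def c_def S_def
    using d by (intro open_INT ballI open_Collect_less) (auto intro!: continuous_intros)
  \<comment> \<open>The corners add up to d - 1 times \<open>w\<close>, so all coordinates of
    \<open>w\<close> equal 1 / (d - 1).\<close>
  moreover have "w \<in> U"
  proof -
    have "?d / (?d - 1) - 1 > 0" using d by (simp add: field_simps)
    moreover have "c w k = ?d / (?d - 1) - 1" if "k \<in> Basis" for k
      using that by (simp add: c_def S_def wf ss)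
    ultimately show ?thesis by (simp add: U_def)
  qed
  moreover have "U \<subseteq> outer_normals M b"
  proof
    fix x assume "x \<in> U"
    then have c: "c x k > 0" if "k \<in> Basis" for k using that by (auto simp: U_def)
    have "x \<noteq> 0"
      using c[OF SOME_Basis] by (auto simp: c_def S_def)
    have corner: "corner f s k = w - s k *\<^sub>R f k" if "k \<in> Basis" for k
      using that by (simp add: corner_def w_def sum_diff1)
    have "(\<Sum>k\<in>Basis. c x k *\<^sub>R corner f s k) = (\<Sum>k\<in>Basis. c x k *\<^sub>R (w - s k *\<^sub>R f k))"
      by (simp add: corner)
    also have "\<dots> = (\<Sum>k\<in>Basis. c x k *\<^sub>R w - (S x / (?d - 1)) *\<^sub>R s k *\<^sub>R f k + (x \<bullet> f k) *\<^sub>R f k)"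
      by (intro sum.cong) (auto simp: c_def algebra_simps ss mult.assoc[symmetric])
    also have "\<dots> = (\<Sum>k\<in>Basis. c x k) *\<^sub>R w - (S x / (?d - 1)) *\<^sub>R w + x"
    proof -
      have "(S x / (?d - 1)) *\<^sub>R w = (\<Sum>k\<in>Basis. (S x / (?d - 1)) *\<^sub>R s k *\<^sub>R f k)"
        by (simp only: w_def scaleR_sum_right)
      then show ?thesis
        by (simp only: sum.distrib sum_subtractf scaleR_sum_left orthonormal_frame_expansion[OF f])
    qed
    also have "(\<Sum>k\<in>Basis. c x k) = ?d * (S x / (?d - 1)) - S x"
      by (simp add: c_def sum_subtractf S_def)
    also have "\<dots> = S x / (?d - 1)" using d by (simp add: field_simps)
    finally have "x = (\<Sum>k\<in>Basis. c x k *\<^sub>R corner f s k)" by simp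
    then show "x \<in> outer_normals M b"
      using outer_normals_combination[of Basis "corner f s" M b "c x"] c g \<open>x \<noteq> 0\<close> by simp
  qed
  ultimately show ?thesis using interior_maximal by blast
qed

section \<open>The equality case for normals orthogonal to a frame\<close>

lemma corners_if_orthogonal_normals:
  fixes n :: "'a::euclidean_space \<Rightarrow> 'a"
  assumes d: "DIM('a) \<ge> 2" and f: "orthonormal_frame f"
    and unit: "\<And>k. k \<in> Basis \<Longrightarrow> norm (n k) = 1"
    and orth: "\<And>k. k \<in> Basis \<Longrightarrow> n k \<bullet> f k = 0"
    and inner: "\<And>k l. k \<in> Basis \<Longrightarrow> l \<in> Basis \<Longrightarrow> n k \<bullet> n l \<ge> (real DIM('a) - 2) / (real DIM('a) - 1)"
  obtains s where "\<And>l. l \<in> Basis \<Longrightarrow> s l \<in> {1, -1}"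
    "\<And>k. k \<in> Basis \<Longrightarrow> sqrt (real DIM('a) - 1) *\<^sub>R n k = corner f s k"
proof -
  let ?B = "Basis :: 'a set"
  let ?d = "real DIM('a)"
  have d1: "?d - 1 > 0" using d by simp
  have card1: "real (card (?B - {l})) = ?d - 1" if "l \<in> ?B" for l
    using that by (simp add: card_Diff_singleton of_nat_diff Suc_leI)
  define a where "a k l = n k \<bullet> f l" for k l
  \<comment> \<open>The mean of the off-diagonal entries of column \<open>l\<close>: the diagonal
    entry is 0, so the full sum is divided by d - 1.\<close>
  define m where "m l = (\<Sum>k\<in>?B. a k l) / (?d - 1)" for l
  have a0: "a k k = 0" if "k \<in> ?B" for k using orth that by (simp add: a_def)
  \<comment> \<open>The deficit in the Cauchy-Schwarz inequality for column \<open>l\<close> is a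
    sum of squared deviations from the mean, so equality will force constant columns off the
    diagonal.\<close>
  have var: "(\<Sum>k\<in>?B - {l}. (a k l - m l)\<^sup>2) = (\<Sum>k\<in>?B. (a k l)\<^sup>2) - (\<Sum>k\<in>?B. a k l)\<^sup>2 / (?d - 1)"
    if l: "l \<in> ?B" for l
  proof -
    have s1: "(\<Sum>k\<in>?B - {l}. a k l) = (\<Sum>k\<in>?B. a k l)"
      and s2: "(\<Sum>k\<in>?B - {l}. (a k l)\<^sup>2) = (\<Sum>k\<in>?B. (a k l)\<^sup>2)"
      using l a0[OF l] by (simp_all add: sum_diff1)
    have "(\<Sum>k\<in>?B - {l}. (a k l - m l)\<^sup>2)
        = (\<Sum>k\<in>?B - {l}. (a k l)\<^sup>2) - 2 * m l * (\<Sum>k\<in>?B - {l}. a k l) + (?d - 1) * (m l)\<^sup>2"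
    proof -
      have "(\<Sum>k\<in>?B - {l}. 2 * a k l * m l) = 2 * m l * (\<Sum>k\<in>?B - {l}. a k l)"
        unfolding sum_distrib_left by (intro sum.cong) auto
      then show ?thesis
        unfolding power2_diff sum.distrib sum_subtractf sum_constant card1[OF l] by simp
    qed
    also have "\<dots> = (\<Sum>k\<in>?B. (a k l)\<^sup>2) - (\<Sum>k\<in>?B. a k l)\<^sup>2 / (?d - 1)"
    proof -
      have "x - 2 * (S / D) * S + D * (S / D)\<^sup>2 = x - S\<^sup>2 / D" if "D > 0" for x S D :: real
        using that by (simp add: field_simps power2_eq_square)
      then show ?thesis unfolding s1 s2 m_def using d1 by blast
    qed
    finally show ?thesis .
  qed
  have rows: "(\<Sum>l\<in>?B. (a k l)\<^sup>2) = 1" if "k \<in> ?B" for k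
    using orthonormal_frame_inner[OF f, of "n k" "n k"] unit[OF that]
    by (simp add: a_def power2_eq_square dot_square_norm)
  have "(\<Sum>l\<in>?B. (\<Sum>k\<in>?B. a k l)\<^sup>2) = (\<Sum>k\<in>?B. n k) \<bullet> (\<Sum>k\<in>?B. n k)"
    unfolding orthonormal_frame_inner[OF f, of "\<Sum>k\<in>?B. n k" "\<Sum>k\<in>?B. n k"]
    by (simp add: a_def inner_sum_left power2_eq_square)
  also have "\<dots> = (\<Sum>k\<in>?B. \<Sum>l\<in>?B. n k \<bullet> n l)"
    unfolding inner_sum_left by (simp add: inner_sum_right)
  \<comment> \<open>The extra term on the diagonal raises the almost smooth bound to 1, the squared
    norm of a unit vector.\<close>
  also have "\<dots> \<ge> (\<Sum>k\<in>?B. \<Sum>l\<in>?B. (?d - 2) / (?d - 1) + (if k = l then 1 / (?d - 1) else 0))"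
  proof (intro sum_mono)
    fix k l assume kl: "k \<in> ?B" "l \<in> ?B"
    show "(?d - 2) / (?d - 1) + (if k = l then 1 / (?d - 1) else 0) \<le> n k \<bullet> n l"
    proof (cases "k = l")
      case True
      then have "n k \<bullet> n l = 1" using unit[OF kl(1)] by (simp add: dot_square_norm)
      then show ?thesis using True d1 by (simp add: field_simps)
    qed (use inner[OF kl] in simp)
  qed
  also have "(\<Sum>k\<in>?B. \<Sum>l\<in>?B. (?d - 2) / (?d - 1) + (if k = l then 1 / (?d - 1) else 0)) = ?d * (?d - 1)"
    using d1 by (simp add: sum.distrib) (simp add: field_simps)
  finally have low: "?d * (?d - 1) \<le> (\<Sum>l\<in>?B. (\<Sum>k\<in>?B. a k l)\<^sup>2)" .
  have "(\<Sum>l\<in>?B. \<Sum>k\<in>?B - {l}. (a k l - m l)\<^sup>2)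
      = (\<Sum>l\<in>?B. \<Sum>k\<in>?B. (a k l)\<^sup>2) - (\<Sum>l\<in>?B. (\<Sum>k\<in>?B. a k l)\<^sup>2) / (?d - 1)"
    by (simp add: var sum_subtractf sum_divide_distrib)
  also have "(\<Sum>l\<in>?B. \<Sum>k\<in>?B. (a k l)\<^sup>2) = ?d"
    by (subst sum.swap) (simp add: rows)
  also have "?d - (\<Sum>l\<in>?B. (\<Sum>k\<in>?B. a k l)\<^sup>2) / (?d - 1) \<le> 0"
    using low d1 by (simp add: field_simps)
  finally have le0: "(\<Sum>l\<in>?B. \<Sum>k\<in>?B - {l}. (a k l - m l)\<^sup>2) \<le> 0" .
  have am: "a k l = m l" if "k \<in> ?B" "l \<in> ?B" "k \<noteq> l" for k l
  proof -
    have "(\<Sum>l\<in>?B. \<Sum>k\<in>?B - {l}. (a k l - m l)\<^sup>2) = 0"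
      using le0 by (intro antisym sum_nonneg) auto
    then have "(\<Sum>k\<in>?B - {l}. (a k l - m l)\<^sup>2) = 0"
      using that by (subst (asm) sum_nonneg_eq_0_iff) (auto intro: sum_nonneg)
    then show ?thesis using that by (subst (asm) sum_nonneg_eq_0_iff) auto
  qed
  have msq: "(m k)\<^sup>2 = 1 / (?d - 1)" if k: "k \<in> ?B" for k
  proof -
    \<comment> \<open>Row \<open>j\<close> has norm 1 and contains every \<open>m l\<close> except
      \<open>m j\<close>. Comparing rows shows that all \<open>(m j)\<^sup>2\<close> agree.\<close>
    have tot: "(\<Sum>l\<in>?B. (m l)\<^sup>2) = 1 + (m j)\<^sup>2" if j: "j \<in> ?B" for j
    proof -
      have "1 = (\<Sum>l\<in>?B - {j}. (a j l)\<^sup>2)" using rows[OF j] a0[OF j] j by (simp add: sum_diff1)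
      also have "\<dots> = (\<Sum>l\<in>?B - {j}. (m l)\<^sup>2)" using am j by (intro sum.cong) auto
      finally show ?thesis using j by (simp add: sum_diff1)
    qed
    then have "(m l)\<^sup>2 = (m k)\<^sup>2" if "l \<in> ?B" for l using that k by (metis add_left_cancel)
    then have "(\<Sum>l\<in>?B. (m l)\<^sup>2) = ?d * (m k)\<^sup>2" by simp
    then have "(?d - 1) * (m k)\<^sup>2 = 1" using tot[OF k] by (simp add: algebra_simps)
    then show ?thesis using d1 by (simp add: field_simps)
  qed
  define s where "s l = sqrt (?d - 1) * m l" for l
  have "(s l)\<^sup>2 = 1" if "l \<in> ?B" for l
    using msq[OF that] d1 by (simp add: s_def power_mult_distrib)
  then have "s l \<in> {1, -1}" if "l \<in> ?B" for l
    using that by (simp add: power2_eq_1_iff)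
  moreover have "sqrt (?d - 1) *\<^sub>R n k = corner f s k" if k: "k \<in> ?B" for k
  proof -
    have "n k = (\<Sum>l\<in>?B. a k l *\<^sub>R f l)"
      by (simp add: a_def orthonormal_frame_expansion[OF f])
    also have "\<dots> = (\<Sum>l\<in>?B - {k}. a k l *\<^sub>R f l)" using a0[OF k] k by (simp add: sum_diff1)
    also have "\<dots> = (\<Sum>l\<in>?B - {k}. m l *\<^sub>R f l)" using am k by (intro sum.cong) auto
    finally show ?thesis by (simp add: corner_def s_def scaleR_sum_right)
  qed
  ultimately show ?thesis using that by blast
qed

section \<open>Rotation in a coordinate plane\<close>

definition rotated_frame :: "'a \<Rightarrow> 'a \<Rightarrow> real \<Rightarrow> 'a \<Rightarrow> 'a::euclidean_space" where
  "rotated_frame i j t k =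
    (if k = i then cos t *\<^sub>R i + sin t *\<^sub>R j
     else if k = j then cos t *\<^sub>R j - sin t *\<^sub>R i else k)"

lemma orthonormal_rotated_frame:
  assumes "i \<in> Basis" "j \<in> Basis" "i \<noteq> j"
  shows "orthonormal_frame (rotated_frame i j t)"
  using assms sin_cos_squared_add3[of t]
  by (auto simp: orthonormal_frame_def rotated_frame_def inner_Basis algebra_simps)

text \<open>The components outside the plane of \<open>i\<close> and \<open>j\<close> contribute at
  most d - 2, so the planar components must have nonnegative inner products. Up to signs these are
  the cosine and sine of \<open>t - u\<close>. The cosine is positive, so \<open>s\<close> and
  \<open>r\<close> agree at \<open>i\<close> and \<open>j\<close>; the two mixed inner products are
  then opposite multiples of the sine, which must vanish.\<close>

lemma corner_rotated_frame_unique: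
  fixes i j :: "'a::euclidean_space"
  assumes ij: "i \<in> Basis" "j \<in> Basis" "i \<noteq> j"
    and s: "\<And>l. l \<in> Basis \<Longrightarrow> s l \<in> {1, -1}" and r: "\<And>l. l \<in> Basis \<Longrightarrow> r l \<in> {1, -1}"
    and t: "\<bar>t - u\<bar> < pi / 2"
    and inner: "\<And>k l. k \<in> {i, j} \<Longrightarrow> l \<in> {i, j} \<Longrightarrow>
      corner (rotated_frame i j t) s k \<bullet> corner (rotated_frame i j u) r l \<ge> real DIM('a) - 2"
  shows "t = u"
proof -
  let ?P = "Basis - {i, j}"
  let ?f = "rotated_frame i j t" and ?h = "rotated_frame i j u"
  define v where "v s = (\<Sum>l\<in>?P. s l *\<^sub>R l)" for s :: "'a \<Rightarrow> real"
  have B: "Basis - {i} = insert j ?P" "Basis - {j} = insert i ?P" using ij by auto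
  have P: "(\<Sum>l\<in>?P. s l *\<^sub>R rotated_frame i j t l) = v s" for s t
    unfolding v_def by (intro sum.cong) (auto simp: rotated_frame_def)
  have corner: "corner (rotated_frame i j t) s i = s j *\<^sub>R (cos t *\<^sub>R j - sin t *\<^sub>R i) + v s"
    "corner (rotated_frame i j t) s j = s i *\<^sub>R (cos t *\<^sub>R i + sin t *\<^sub>R j) + v s" for s t
    unfolding corner_def B using ij by (simp_all add: P) (simp_all add: rotated_frame_def)
  have vB: "v s \<bullet> i = 0" "v s \<bullet> j = 0" "i \<bullet> v s = 0" "j \<bullet> v s = 0" for s
  proof -
    have "l \<bullet> i = 0" "l \<bullet> j = 0" if "l \<in> ?P" for l
      using ij that by (auto intro: inner_not_same_Basis)
    then show "v s \<bullet> i = 0" "v s \<bullet> j = 0" by (simp_all add: v_def inner_sum_left)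
    then show "i \<bullet> v s = 0" "j \<bullet> v s = 0" by (simp_all add: inner_commute)
  qed
  have "v s \<bullet> v r = (\<Sum>l\<in>?P. s l * r l)"
    unfolding v_def inner_sum_left
  proof (intro sum.cong refl)
    fix k assume k: "k \<in> ?P"
    have "k \<bullet> (\<Sum>l\<in>?P. r l *\<^sub>R l) = (\<Sum>l\<in>?P. if k = l then r l else 0)"
      unfolding inner_sum_right using k by (intro sum.cong) (auto simp: inner_Basis)
    then show "s k *\<^sub>R k \<bullet> (\<Sum>l\<in>?P. r l *\<^sub>R l) = s k * r k" using k by simp
  qed
  also have "\<dots> \<le> (\<Sum>l\<in>?P. 1)"
  proof (rule sum_mono)
    fix l assume "l \<in> ?P"
    then show "s l * r l \<le> 1" using s[of l] r[of l] by auto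
  qed
  also have "\<dots> = real DIM('a) - 2"
  proof -
    have "card {i, j} \<le> DIM('a)" using ij by (intro card_mono) auto
    then show ?thesis using ij by (simp add: card_Diff_subset of_nat_diff)
  qed
  finally have v: "v s \<bullet> v r \<le> real DIM('a) - 2" .
  have "0 \<le> s j * r j * cos (t - u)" "0 \<le> s j * r i * - sin (t - u)"
    "0 \<le> s i * r j * sin (t - u)"
    using inner[of i i] inner[of i j] inner[of j i] v ij
    by (simp_all add: corner inner_add_left inner_add_right inner_diff_left inner_diff_right
        inner_Basis vB cos_diff sin_diff algebra_simps)
  moreover have "0 \<le> s i * r i * cos (t - u)"
    using inner[of j j] v ij
    by (simp add: corner inner_add_left inner_add_right inner_Basis vB cos_diff algebra_simps)
  moreover have "cos (t - u) > 0" using t by (intro cos_gt_zero_pi) linarith+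
  ultimately have "sin (t - u) = 0"
    using s[OF ij(1)] s[OF ij(2)] r[OF ij(1)] r[OF ij(2)] by auto
  moreover have "- pi < t - u" "t - u < pi" using t pi_gt_zero by linarith+
  ultimately show ?thesis using sin_eq_0_pi[of "t - u"] by simp
qed

section \<open>Choosing a frame for an almost smooth body\<close>

lemma almost_smooth_inner_ge:
  fixes M :: "'a::euclidean_space set"
  assumes "almost_smooth M" "b \<in> frontier M" "m \<in> outer_normals M b" "n \<in> outer_normals M b"
  shows "(real DIM('a) - 2) / (real DIM('a) - 1) * (norm m * norm n) \<le> m \<bullet> n"
proof -
  have "norm m * norm n > 0" using assms(3,4) by (auto simp: outer_normals_def)
  moreover have "(real DIM('a) - 2) / (real DIM('a) - 1) \<le> (m \<bullet> n) / (norm m * norm n)"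
    using assms by (auto simp: almost_smooth_def)
  ultimately show ?thesis by (simp only: pos_le_divide_eq)
qed

text \<open>After scaling to unit length, almost smoothness bounds the inner products of the normals
  directly. The factor relating them to corners is positive and so preserves outer normals.\<close>

lemma almost_smooth_obtain_corners:
  fixes M :: "'a::euclidean_space set"
  assumes M: "almost_smooth M" "b \<in> frontier M" and d: "DIM('a) \<ge> 2" and f: "orthonormal_frame f"
    and orth: "\<And>k. k \<in> Basis \<Longrightarrow> \<exists>n\<in>outer_normals M b. n \<bullet> f k = 0"
  obtains s where "\<And>l. l \<in> Basis \<Longrightarrow> s l \<in> {1, -1}"
    "\<And>k. k \<in> Basis \<Longrightarrow> corner f s k \<in> outer_normals M b"
proof -
  obtain p where p: "\<And>k. k \<in> Basis \<Longrightarrow> p k \<in> outer_normals M b \<and> p k \<bullet> f k = 0"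
    using orth by metis
  define n where "n k = (1 / norm (p k)) *\<^sub>R p k" for k
  have N: "n k \<in> outer_normals M b" and unit: "norm (n k) = 1" and "n k \<bullet> f k = 0"
    if "k \<in> Basis" for k
    using p[OF that] outer_normals_scaleR[of "p k" M b "1 / norm (p k)"]
    by (auto simp: n_def outer_normals_def)
  moreover have "(real DIM('a) - 2) / (real DIM('a) - 1) \<le> n k \<bullet> n l"
    if "k \<in> Basis" "l \<in> Basis" for k l
    using almost_smooth_inner_ge[OF M N[OF that(1)] N[OF that(2)]] that by (simp add: unit)
  ultimately obtain s where "\<And>l. l \<in> Basis \<Longrightarrow> s l \<in> {1, -1}"
    and s: "\<And>k. k \<in> Basis \<Longrightarrow> sqrt (real DIM('a) - 1) *\<^sub>R n k = corner f s k"
    using corners_if_orthogonal_normals[OF d f, of n] by blast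
  moreover have "corner f s k \<in> outer_normals M b" if "k \<in> Basis" for k
    unfolding s[OF that, symmetric]
    using outer_normals_scaleR[OF N[OF that]] d by simp
  ultimately show ?thesis using that by blast
qed

lemma almost_smooth_obtain_frame:
  fixes M :: "'a::euclidean_space set"
  assumes d: "DIM('a) \<ge> 2" and M: "almost_smooth M" "closed M"
  obtains f :: "'a \<Rightarrow> 'a" where "orthonormal_frame f"
    "\<And>b. b \<in> frontier M \<Longrightarrow> \<exists>k\<in>Basis. \<forall>n\<in>outer_normals M b. n \<bullet> f k \<noteq> 0"
proof -
  have "\<not> (\<exists>i::'a. Basis \<subseteq> {i})"
    using d card_mono[of "{_}" "Basis :: 'a set"] by fastforce
  then obtain i j :: 'a where ij: "i \<in> Basis" "j \<in> Basis" "i \<noteq> j"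
    by blast
  let ?f = "rotated_frame i j" and ?I = "\<lambda>b. interior (outer_normals M b)"
  have f: "orthonormal_frame (?f t)" for t using ij by (rule orthonormal_rotated_frame)
  \<comment> \<open>The interval is uncountable and shorter than \<open>pi / 2\<close>, as the
    uniqueness of the angle requires.\<close>
  have "\<exists>t\<in>{0..1}. \<forall>b\<in>frontier M. \<exists>k\<in>Basis. \<forall>n\<in>outer_normals M b. n \<bullet> ?f t k \<noteq> 0"
  proof (rule ccontr)
    assume bad: "\<not> ?thesis"
    have "\<exists>b s. b \<in> frontier M \<and> s ` Basis \<subseteq> {1, -1} \<and>
        corner (?f t) s ` Basis \<subseteq> outer_normals M b" if "t \<in> {0..1}" for t
    proof -
      obtain b where b: "b \<in> frontier M"
        "\<And>k. k \<in> Basis \<Longrightarrow> \<exists>n\<in>outer_normals M b. n \<bullet> ?f t k = 0"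
        using bad \<open>t \<in> {0..1}\<close> by blast
      then show ?thesis
        using almost_smooth_obtain_corners[OF M(1) b(1) d f b(2)] by (metis image_subsetI)
    qed
    then obtain b s where bs: "\<And>t. t \<in> {0..1} \<Longrightarrow> b t \<in> frontier M \<and> s t ` Basis \<subseteq> {1, -1} \<and>
        corner (?f t) (s t) ` Basis \<subseteq> outer_normals M (b t)"
      by metis
    have b: "b t \<in> frontier M" if "t \<in> {0..1}" for t using bs[OF that] by simp
    have s: "s t l \<in> {1, -1}" if "t \<in> {0..1}" "l \<in> Basis" for t l
      using bs[OF that(1)] that(2) by (simp only: image_subset_iff)
    have g: "corner (?f t) (s t) k \<in> outer_normals M (b t)" if "t \<in> {0..1}" "k \<in> Basis" for t k
      using bs[OF that(1)] that(2) by (simp only: image_subset_iff)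
    have bM: "b t \<in> M" if "t \<in> {0..1}" for t
      using b[OF that] M(2) frontier_subset_closed by blast
    have inj: "t = u" if tu: "t \<in> {0..1}" "u \<in> {0..1}" and eq: "b t = b u" for t u
    proof (rule corner_rotated_frame_unique[OF ij])
      have "\<bar>t - u\<bar> \<le> 1" using tu by auto
      then show "\<bar>t - u\<bar> < pi / 2" using pi_gt3 by linarith
      fix k l assume "k \<in> {i, j}" "l \<in> {i, j}"
      then have kl: "k \<in> Basis" "l \<in> Basis" using ij by auto
      \<comment> \<open>Both corners are normals at the same point. Multiplying the almost smooth
        bound by this product of norms leaves exactly d - 2.\<close>
      have "norm (corner (?f t) (s t) k) * norm (corner (?f u) (s u) l) = real DIM('a) - 1"
      proof -
        have "norm (corner (?f t) (s t) k) = sqrt (real DIM('a) - 1)"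
          by (rule norm_corner[OF f kl(1)]) (rule s[OF tu(1)])
        moreover have "norm (corner (?f u) (s u) l) = sqrt (real DIM('a) - 1)"
          by (rule norm_corner[OF f kl(2)]) (rule s[OF tu(2)])
        ultimately show ?thesis using d by simp
      qed
      then show "real DIM('a) - 2 \<le> corner (?f t) (s t) k \<bullet> corner (?f u) (s u) l"
        using almost_smooth_inner_ge[OF M(1) b[OF tu(1)] g[OF tu(1) kl(1)], of "corner (?f u) (s u) l"]
          g[OF tu(2) kl(2)] d by (simp add: eq)
    next
      show "s t l \<in> {1, -1}" if "l \<in> Basis" for l using s[OF tu(1) that] .
      show "s u l \<in> {1, -1}" if "l \<in> Basis" for l using s[OF tu(2) that] .
    qed
    have ne: "?I (b t) \<noteq> {}" if "t \<in> {0..1}" for t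
      by (rule interior_outer_normals_corners[OF d f[of t], of "s t"]) (use s g that in auto)
    have disj: "?I (b t) \<inter> ?I (b u) = {}" if "t \<in> {0..1}" "u \<in> {0..1}" "t \<noteq> u" for t u
      using inj[OF that(1,2)] that(3) by (intro interior_outer_normals_disjoint bM that) auto
    \<comment> \<open>Distinct angles would give disjoint nonempty open sets, and a Euclidean space
      holds only countably many of these.\<close>
    have "countable ((\<lambda>t. ?I (b t)) ` {0..1})"
    proof (rule countable_disjoint_open_subsets)
      show "pairwise disjnt ((\<lambda>t. ?I (b t)) ` {0..1})"
        using disj by (intro pairwise_imageI) (simp add: disjnt_def)
    qed auto
    moreover have "inj_on (\<lambda>t. ?I (b t)) {0..1}"
    proof (rule inj_onI)
      fix t u assume tu: "t \<in> {0..1}" "u \<in> {0..1}" "?I (b t) = ?I (b u)"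
      then show "t = u" using disj[OF tu(1,2)] ne[OF tu(1)] by auto
    qed
    ultimately show False
      using countable_image_inj_on uncountable_closed_interval[of 0 1] by auto
  qed
  then show ?thesis using that f by blast
qed

section \<open>Attaining the lower bound with a frame\<close>

theorem theorem2p3:
  fixes M :: "'a::euclidean_space set"
  assumes "DIM('a) \<ge> 3"
    and "convex_body M"
    and "almost_smooth M"
  shows "xray_number M = DIM('a)"
proof -
  have cl: "closed M" using assms(2) by (auto simp: convex_body_def compact_imp_closed)
  have d: "DIM('a) \<ge> 2" using assms(1) by simp
  obtain f :: "'a \<Rightarrow> 'a" where f: "orthonormal_frame f"
    and reg: "\<And>b. b \<in> frontier M \<Longrightarrow> \<exists>k\<in>Basis. \<forall>n\<in>outer_normals M b. n \<bullet> f k \<noteq> 0"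
    using almost_smooth_obtain_frame[OF d assms(3) cl] by blast
  define \<L> where "\<L> = (\<lambda>k. span {f k}) ` (Basis :: 'a set)"
  have fin: "finite \<L>" by (simp add: \<L>_def)
  have "f k \<noteq> 0" if "k \<in> Basis" for k
    using f that by (force simp: orthonormal_frame_def)
  then have lines: "\<forall>L\<in>\<L>. origin_line L" by (auto simp: \<L>_def origin_line_def)
  have "\<exists>L\<in>\<L>. xrayed_along M L p" if p: "p \<in> M" for p
  proof (cases "p \<in> interior M")
    case True
    have "\<L> \<noteq> {}" by (simp add: \<L>_def)
    then show ?thesis using lines True xrayed_along_interior by blast
  next
    case False
    then have "p \<in> frontier M" using p cl by (simp add: frontier_def)
    then obtain k where "k \<in> Basis" "\<forall>n\<in>outer_normals M p. n \<bullet> f k \<noteq> 0"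
      using reg by blast
    \<comment> \<open>If the line along \<open>f k\<close> missed the interior, some normal at
      \<open>p\<close> would be orthogonal to \<open>f k\<close>.\<close>
    then show ?thesis
      using obtain_normal_not_xrayed[OF assms(2) p, of "f k"] by (auto simp: \<L>_def)
  qed
  then have xr: "\<forall>p\<in>M. \<exists>L\<in>\<L>. xrayed_along M L p" by blast
  \<comment> \<open>The lower bound supplies the converse, so distinctness of the frame lines need
    not be shown separately.\<close>
  have "card \<L> \<le> DIM('a)" unfolding \<L>_def by (rule card_image_le) simp
  then have "card \<L> = DIM('a)"
    using card_xraying_lines_ge[OF assms(2) fin lines xr] by simp
  then show ?thesis
    unfolding xray_number_def using fin lines xr card_xraying_lines_ge[OF assms(2)]
    by (intro Least_equality) blast+
qed

end
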